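(* For all integers $m,n\ge 3$, the $m\times n$ cylindric grid graph $\mathrm{CGr}_{m,n}$ has representation number $\mathcal{R}(\mathrm{CGr}_{m,n})=3$.
   Context: For $n\ge 3$, the cylindric grid graph $\mathrm{CGr}_{m,n}$ has vertex set $\{x_{i,j} : 1\le i\le m,\ 1\le j\le n\}$ and edge set $\{x_{i,j}x_{i,j+1} : 1\le i\le m,\ 1\le j\le n-1\}\cup\{x_{i,j}x_{i+1,j} : 1\le i\le m-1,\ 1\le j\le n\}\cup\{x_{i,1}x_{i,n} : 1\le i\le m\}$ (the Cartesian product of the path $P_m$ and the cycle $C_n$). Two distinct letters $x,y$ alternate in a word $w$ if, after deleting all other letters from $w$, the remaining word has the form $xyxy\cdots$ or $yxyx\cdots$ (of even or odd length). A word $w$ over the alphabet $V$, in which every letter of $V$ occurs, represents a simple graph $G=(V,E)$ if for all distinct $x,y\in V$, $x$ and $y$ alternate in $w$ if and only if $xy\in E$. A graph is word-representable if some word represents it. It is $k$-representable if it is represented by a word in which each letter of $V$ occurs exactly $k$ times. Every word-representable graph is $k$-representable for some $k\geq 1$; the representation number $\mathcal{R}(G)$ is the minimum such $k$, with $\mathcal{R}(G)=\infty$ if $G$ is not word-representable. *)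

theory Defs
  imports "HOL-Library.Extended_Nat"
begin

text \<open>An undirected graph is a pair \<open>(V, E)\<close> of vertices and edges, an edge \<open>xy\<close> being the
  unordered pair \<open>{x, y}\<close>.\<close>

type_synonym 'a ugraph = "'a set \<times> 'a set set"

definition simple_graph :: "'a ugraph \<Rightarrow> bool" where
  "simple_graph G \<longleftrightarrow> snd G \<subseteq> {{x, y} |x y. x \<in> fst G \<and> y \<in> fst G \<and> x \<noteq> y}"

text \<open>\<open>alt_word x y l\<close> is the word \<open>xyxy\<dots>\<close> of length \<open>l\<close>.\<close>

primrec alt_word :: "'a \<Rightarrow> 'a \<Rightarrow> nat \<Rightarrow> 'a list" where
  "alt_word x y 0 = []"
| "alt_word x y (Suc l) = x # alt_word y x l"

definition alternate :: "'a list \<Rightarrow> 'a \<Rightarrow> 'a \<Rightarrow> bool" where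
  "alternate w x y \<longleftrightarrow>
     (\<exists>l. filter (\<lambda>z. z = x \<or> z = y) w = alt_word x y l \<or>
          filter (\<lambda>z. z = x \<or> z = y) w = alt_word y x l)"

definition represents :: "'a list \<Rightarrow> 'a ugraph \<Rightarrow> bool" where
  "represents w G \<longleftrightarrow> set w = fst G \<and>
     (\<forall>x\<in>fst G. \<forall>y\<in>fst G. x \<noteq> y \<longrightarrow> (alternate w x y \<longleftrightarrow> {x, y} \<in> snd G))"

definition word_representable :: "'a ugraph \<Rightarrow> bool" where
  "word_representable G \<longleftrightarrow> (\<exists>w. represents w G)"

definition k_representable :: "nat \<Rightarrow> 'a ugraph \<Rightarrow> bool" where
  "k_representable k G \<longleftrightarrow> (\<exists>w. represents w G \<and> (\<forall>x\<in>fst G. count_list w x = k))"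

text \<open>The infimum in \<^typ>\<open>enat\<close> is the minimum, since the set is nonempty for every
  word-representable graph.\<close>

definition representation_number :: "'a ugraph \<Rightarrow> enat" where
  "representation_number G =
     (if word_representable G then Inf {enat k |k. k \<ge> 1 \<and> k_representable k G} else \<infinity>)"

text \<open>The vertex \<open>x\<^sub>i\<^sub>,\<^sub>j\<close> is the pair \<open>(i, j)\<close>; the definition is meant for \<open>n \<ge> 3\<close>.\<close>

definition cylindric_grid :: "nat \<Rightarrow> nat \<Rightarrow> (nat \<times> nat) ugraph" where
  "cylindric_grid m n =
     ({(i, j) |i j. 1 \<le> i \<and> i \<le> m \<and> 1 \<le> j \<and> j \<le> n},
      {{(i, j), (i, j + 1)} |i j. 1 \<le> i \<and> i \<le> m \<and> 1 \<le> j \<and> j \<le> n - 1} \<union>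
      {{(i, j), (i + 1, j)} |i j. 1 \<le> i \<and> i \<le> m - 1 \<and> 1 \<le> j \<and> j \<le> n} \<union>
      {{(i, 1), (i, n)} |i. 1 \<le> i \<and> i \<le> m})"

lemma simple_graph_cylindric_grid:
  assumes "n \<ge> 3"
  shows "simple_graph (cylindric_grid m n)"
proof -
  have "\<exists>x y. e = {x, y} \<and> x \<in> fst (cylindric_grid m n) \<and> y \<in> fst (cylindric_grid m n) \<and> x \<noteq> y"
    if e: "e \<in> snd (cylindric_grid m n)" for e
  proof -
    from e consider
        (row) i j where "e = {(i, j), (i, j + 1)}" "1 \<le> i" "i \<le> m" "1 \<le> j" "j \<le> n - 1"
      | (col) i j where "e = {(i, j), (i + 1, j)}" "1 \<le> i" "i \<le> m - 1" "1 \<le> j" "j \<le> n"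
      | (wrap) i where "e = {(i, 1), (i, n)}" "1 \<le> i" "i \<le> m"
      unfolding cylindric_grid_def by auto
    then show ?thesis
    proof cases
      case row
      then show ?thesis
        using assms by (intro exI[of _ "(i, j)"] exI[of _ "(i, j + 1)"]) (auto simp: cylindric_grid_def)
    next
      case col
      then show ?thesis
        by (intro exI[of _ "(i, j)"] exI[of _ "(i + 1, j)"]) (auto simp: cylindric_grid_def)
    next
      case wrap
      then show ?thesis
        using assms by (intro exI[of _ "(i, 1)"] exI[of _ "(i, n)"]) (auto simp: cylindric_grid_def)
    qed
  qed
  then show ?thesis
    unfolding simple_graph_def by blast
qed

end

theory Submission
  imports Defs "HOL-Library.Product_Lexorder" "HOL-Library.Disjoint_Sets"
begin

text \<open>
  Two letters alternate iff between any two occurrences of one there is an occurrence of the other,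
  so a uniform word may be given by assigning to each letter a set of keys in a linear order.

  Upper bound: an explicit assignment of three keys to every vertex, checked by comparing keys.

  Lower bound: a 2-uniform word is a chord diagram in which alternation means crossing. If
  \<open>n \<ge> 4\<close>, the columns 1, 2, 3 induce a 3 by 3 grid. The four neighbours of its centre are pairwise
  disjoint chords crossing the central chord, hence linearly ordered along it; a corner
  crosses exactly two of them and avoids the central chord, so these two are consecutive. This would embed a
  4-cycle into a path with four vertices. If \<open>n = 3\<close>, the first row is a triangle whose six ends alternate
  around the circle; a chord crossing exactly one side of it cuts off a single one of these ends, and
  three such chords for the three sides cannot cross pairwise, because no three of the six
  ends are pairwise neighbours on the circle.
\<close>

section \<open>Alternation and occurrence sets\<close>

lemma distinct_adj_alt_word: "x \<noteq> y \<Longrightarrow> distinct_adj (alt_word x y l)"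
proof (induction l arbitrary: x y)
  case (Suc l)
  then show ?case by (cases l) (auto simp: distinct_adj_Cons)
qed simp

lemma alt_word_of_distinct_adj:
  "distinct_adj u \<Longrightarrow> set u \<subseteq> {x, y} \<Longrightarrow> x \<noteq> y \<Longrightarrow>
     u = alt_word x y (length u) \<or> u = alt_word y x (length u)"
proof (induction u)
  case (Cons a u)
  then show ?case by (cases u) (auto simp: distinct_adj_Cons)
qed simp

lemma alternate_iff_distinct_adj:
  assumes "x \<noteq> y"
  shows "alternate w x y \<longleftrightarrow> distinct_adj (filter (\<lambda>z. z = x \<or> z = y) w)"
proof
  assume "alternate w x y"
  then show "distinct_adj (filter (\<lambda>z. z = x \<or> z = y) w)"
    using assms unfolding alternate_def by (metis distinct_adj_alt_word)
next
  assume "distinct_adj (filter (\<lambda>z. z = x \<or> z = y) w)"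
  moreover have "set (filter (\<lambda>z. z = x \<or> z = y) w) \<subseteq> {x, y}" by auto
  ultimately show "alternate w x y"
    using alt_word_of_distinct_adj[OF _ _ assms] unfolding alternate_def by blast
qed

text \<open>By induction, the new least key \<open>k\<close> adds only one condition: the next key
  that survives the filter, if any, carries another label. A next survivor with the same label
  leaves no room for a witness; one with another label lies before every later repetition of
  \<open>lab k\<close>.\<close>

lemma distinct_adj_filter_map_iff:
  fixes ks :: "'k :: linorder list"
  assumes "sorted_wrt (<) ks"
  shows "distinct_adj (filter P (map lab ks)) \<longleftrightarrow>
    (\<forall>a\<in>set ks. \<forall>b\<in>set ks. a < b \<and> lab a = lab b \<and> P (lab a) \<longrightarrow>
       (\<exists>c\<in>set ks. a < c \<and> c < b \<and> P (lab c) \<and> lab c \<noteq> lab a))"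
  using assms
proof (induction ks)
  case (Cons k ks)
  note srtd = Cons.prems and IH = Cons.IH
  let ?Q = "\<lambda>S. \<forall>a\<in>S. \<forall>b\<in>S. a < b \<and> lab a = lab b \<and> P (lab a) \<longrightarrow>
       (\<exists>c\<in>S. a < c \<and> c < b \<and> P (lab c) \<and> lab c \<noteq> lab a)"
  let ?R = "\<forall>b\<in>set ks. lab k = lab b \<longrightarrow> (\<exists>c\<in>set ks. c < b \<and> P (lab c) \<and> lab c \<noteq> lab k)"
  have kmin: "k < b" if "b \<in> set ks" for b using srtd that by auto
  then have nk: "\<not> b < k" if "b \<in> set ks" for b using that less_asym by blast
  have step: "?Q (set (k # ks)) \<longleftrightarrow> ?Q (set ks) \<and> (P (lab k) \<longrightarrow> ?R)"
    by (auto simp: kmin nk cong: ball_cong bex_cong)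
  have head: "?R \<longleftrightarrow> filter P (map lab ks) = [] \<or> lab k \<noteq> hd (filter P (map lab ks))"
    if Pk: "P (lab k)"
  proof (cases "filter P (map lab ks)")
    case Nil
    then show ?thesis using Pk by (auto simp: filter_empty_conv)
  next
    case (Cons x xs)
    then have "filter (P \<circ> lab) ks \<noteq> []" by (auto simp: filter_map)
    then obtain c cs where "filter (P \<circ> lab) ks = c # cs" by (cases "filter (P \<circ> lab) ks") auto
    then obtain us vs where ks: "ks = us @ c # vs" "\<forall>u\<in>set us. \<not> P (lab u)" "P (lab c)"
      by (auto simp: filter_eq_Cons_iff)
    then have x: "x = lab c" using Cons by auto
    have srt: "\<forall>b\<in>set vs. c < b" "\<forall>b\<in>set us. b < c"
      using srtd ks(1) by (auto simp: sorted_wrt_append)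
    show ?thesis
    proof (cases "lab c = lab k")
      case True
      then have "\<not> ?R" using ks srt by (auto dest: less_asym)
      then show ?thesis using True Cons x by simp
    next
      case False
      then have "?R" using ks srt Pk by auto
      then show ?thesis using False Cons x by simp
    qed
  qed
  have IH': "distinct_adj (filter P (map lab ks)) \<longleftrightarrow> ?Q (set ks)"
    using srtd by (intro IH) simp
  have "distinct_adj (filter P (map lab (k # ks))) \<longleftrightarrow>
      distinct_adj (filter P (map lab ks)) \<and> (P (lab k) \<longrightarrow> ?R)"
  proof (cases "P (lab k)")
    case True
    then show ?thesis unfolding head[OF True] by (auto simp: distinct_adj_Cons)
  next
    case False
    then show ?thesis by simp
  qed
  then show ?case unfolding step IH' .
qed simp

text \<open>One half of alternation. For finite \<open>A\<close>, quantifying over all pairs instead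
  of consecutive ones gives the same condition without enumerating the set.\<close>

definition splits :: "'k :: linorder set \<Rightarrow> 'k set \<Rightarrow> bool" where
  "splits B A \<longleftrightarrow> (\<forall>a\<in>A. \<forall>b\<in>A. a < b \<longrightarrow> (\<exists>c\<in>B. a < c \<and> c < b))"

lemma alternate_map_iff_splits:
  fixes ks :: "'k :: linorder list"
  assumes "sorted_wrt (<) ks" "x \<noteq> y"
  shows "alternate (map lab ks) x y \<longleftrightarrow>
    splits {k \<in> set ks. lab k = y} {k \<in> set ks. lab k = x} \<and>
    splits {k \<in> set ks. lab k = x} {k \<in> set ks. lab k = y}"
  unfolding alternate_iff_distinct_adj[OF assms(2)] distinct_adj_filter_map_iff[OF assms(1)] splits_def
  using assms(2) by (auto; metis)

definition occurrences :: "'a list \<Rightarrow> 'a \<Rightarrow> nat set" where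
  "occurrences w x = {p. p < length w \<and> w ! p = x}"

lemma card_occurrences: "card (occurrences w x) = count_list w x"
  unfolding occurrences_def count_list_eq_length_filter length_filter_conv_card
  by (metis eq_commute)

lemma alternate_iff_occurrences:
  assumes "x \<noteq> y"
  shows "alternate w x y \<longleftrightarrow>
    splits (occurrences w y) (occurrences w x) \<and> splits (occurrences w x) (occurrences w y)"
  using alternate_map_iff_splits[OF _ assms, of "[0..<length w]" "(!) w"]
  by (simp add: map_nth occurrences_def)

text \<open>The word arises by sorting the union of the key sets and replacing each key by its
  owner, which is unique by disjointness. Keys from any linear order can thus serve as
  positions.\<close>

lemma word_of_occurrences:
  fixes K :: "'a \<Rightarrow> 'k :: linorder set"
  assumes V: "finite V" and fin: "\<And>x. x \<in> V \<Longrightarrow> finite (K x)" and disj: "disjoint_family_on K V"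
  obtains w where "set w \<subseteq> V" "\<And>x. x \<in> V \<Longrightarrow> count_list w x = card (K x)"
    "\<And>x y. x \<in> V \<Longrightarrow> y \<in> V \<Longrightarrow> x \<noteq> y \<Longrightarrow>
       alternate w x y \<longleftrightarrow> splits (K y) (K x) \<and> splits (K x) (K y)"
proof -
  define S where "S = \<Union> (K ` V)"
  define ks where "ks = sorted_list_of_set S"
  define lab where "lab k = (THE x. x \<in> V \<and> k \<in> K x)" for k
  have finS: "finite S" using V fin by (auto simp: S_def)
  then have ks: "sorted_wrt (<) ks" "set ks = S" "distinct ks" by (auto simp: ks_def)
  have lab: "lab k = x" if "x \<in> V" "k \<in> K x" for k x
    unfolding lab_def using that disj by (intro the_equality) (auto simp: disjoint_family_on_def)
  then have K: "{k \<in> set ks. lab k = x} = K x" if "x \<in> V" for x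
    using that by (auto simp: ks S_def)
  show thesis
  proof
    show "set (map lab ks) \<subseteq> V" using lab by (auto simp: ks S_def)
    show "count_list (map lab ks) x = card (K x)" if "x \<in> V" for x
    proof -
      have "count_list (map lab ks) x = length (filter (\<lambda>k. lab k = x) ks)"
        by (simp add: count_list_eq_length_filter filter_map o_def eq_commute)
      also have "\<dots> = card (set (filter (\<lambda>k. lab k = x) ks))"
        using ks(3) by (metis distinct_card distinct_filter)
      finally show ?thesis using K[OF that] by simp
    qed
    show "alternate (map lab ks) x y \<longleftrightarrow> splits (K y) (K x) \<and> splits (K x) (K y)"
      if "x \<in> V" "y \<in> V" "x \<noteq> y" for x y
      using alternate_map_iff_splits[OF ks(1) that(3)] K that by simp
  qed
qed

section \<open>Key sets with two or three elements\<close>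

lemma splits_pair:
  fixes a b :: "'k :: linorder"
  shows "a < b \<Longrightarrow> splits B {a, b} \<longleftrightarrow> (\<exists>x\<in>B. a < x \<and> x < b)"
  unfolding splits_def by (auto dest: less_asym)

lemma splits_triple:
  fixes a b c :: "'k :: linorder"
  assumes "a < b" "b < c"
  shows "splits B {a, b, c} \<longleftrightarrow> (\<exists>x\<in>B. a < x \<and> x < b) \<and> (\<exists>x\<in>B. b < x \<and> x < c)"
  using assms unfolding splits_def by (auto dest: less_asym less_trans)

text \<open>One splitting condition forces the whole order once it is known which triple starts
  first: \<open>a\<close> lies before both gaps of the other triple, so these gaps contain
  \<open>b\<close> and \<open>c\<close>, in this order.\<close>

lemma splits_tripleD:
  fixes a b c :: "'k :: linorder"
  assumes "a < b" "b < c" "a' < b'" "b' < c'" "a < a'" "splits {a, b, c} {a', b', c'}"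
  shows "a' < b \<and> b < b' \<and> b' < c \<and> c < c'"
proof -
  obtain x y where xy: "x \<in> {a, b, c}" "a' < x" "x < b'" "y \<in> {a, b, c}" "b' < y" "y < c'"
    using assms(3,4,6) by (auto simp only: splits_triple)
  have "x \<noteq> a" "y \<noteq> a" using xy assms by auto
  moreover have "y \<noteq> b" using xy assms calculation by auto
  moreover have "x \<noteq> c" using xy assms calculation by auto
  ultimately show ?thesis using xy by auto
qed

definition interleaved :: "'k :: linorder \<Rightarrow> 'k \<Rightarrow> 'k \<Rightarrow> 'k \<Rightarrow> 'k \<Rightarrow> 'k \<Rightarrow> bool" where
  "interleaved a b c a' b' c' \<longleftrightarrow> a < a' \<and> a' < b \<and> b < b' \<and> b' < c \<and> c < c'"

lemma splits_triple_iff: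
  fixes a b c :: "'k :: linorder"
  assumes "a < b" "b < c" "a' < b'" "b' < c'" "a \<noteq> a'"
  shows "splits {a', b', c'} {a, b, c} \<and> splits {a, b, c} {a', b', c'} \<longleftrightarrow>
    interleaved a b c a' b' c' \<or> interleaved a' b' c' a b c"
    (is "?L \<longleftrightarrow> ?R")
proof
  assume ?L
  then show ?R
    using splits_tripleD[of a b c a' b' c'] splits_tripleD[of a' b' c' a b c] assms
    unfolding interleaved_def by (metis neqE)
next
  assume ?R
  then show ?L using assms unfolding interleaved_def by (auto simp only: splits_triple)
qed

lemma splits_pairD:
  fixes a b :: "'k :: linorder"
  assumes "a < b" "a' < b'" "a < a'" "splits {a, b} {a', b'}"
  shows "a' < b \<and> b < b'"
  using assms by (auto simp add: splits_pair)

lemma splits_pair_iff: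
  fixes a b :: "'k :: linorder"
  assumes "a < b" "a' < b'" "a \<noteq> a'"
  shows "splits {a', b'} {a, b} \<and> splits {a, b} {a', b'} \<longleftrightarrow>
    a < a' \<and> a' < b \<and> b < b' \<or> a' < a \<and> a < b' \<and> b' < b"
    (is "?L \<longleftrightarrow> ?R")
proof
  assume ?L
  then show ?R
    using splits_pairD[of a b a' b'] splits_pairD[of a' b' a b] assms by (metis neqE)
next
  assume ?R
  then show ?L using assms by (auto simp only: splits_pair)
qed

text \<open>A singleton has no gap to split. Hence a 1-uniform word represents only complete
  graphs.\<close>

lemma alternate_if_1_uniform:
  assumes "x \<noteq> y" "count_list w x = 1" "count_list w y = 1"
  shows "alternate w x y"
proof -
  have "card (occurrences w x) = 1" "card (occurrences w y) = 1"
    using assms by (simp_all add: card_occurrences)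
  then show ?thesis
    unfolding alternate_iff_occurrences[OF assms(1)] by (auto simp: card_1_singleton_iff splits_def)
qed

section \<open>A 3-uniform word for the cylindric grid\<close>

text \<open>The edge relation as plain arithmetic without index bounds, so that it can be evaluated
  case by case and restricted to smaller grids.\<close>

definition adjacent :: "nat \<Rightarrow> nat \<times> nat \<Rightarrow> nat \<times> nat \<Rightarrow> bool" where
  "adjacent n x y \<longleftrightarrow> (case (x, y) of ((i, j), (i', j')) \<Rightarrow>
     i = i' \<and> (j' = j + 1 \<or> j = j' + 1 \<or> j = 1 \<and> j' = n \<or> j = n \<and> j' = 1) \<or>
     j = j' \<and> (i' = i + 1 \<or> i = i' + 1))"

lemma adjacent_simp: "adjacent n (i, j) (i', j') \<longleftrightarrow>
     i = i' \<and> (j' = j + 1 \<or> j = j' + 1 \<or> j = 1 \<and> j' = n \<or> j = n \<and> j' = 1) \<or>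
     j = j' \<and> (i' = i + 1 \<or> i = i' + 1)"
  by (simp add: adjacent_def)

lemma adjacent_commute: "adjacent n x y \<longleftrightarrow> adjacent n y x"
  unfolding adjacent_def by auto

lemma cylindric_grid_vertices: "fst (cylindric_grid m n) = {1..m} \<times> {1..n}"
  unfolding cylindric_grid_def by auto

lemma cylindric_grid_edge_iff:
  assumes "x \<in> {1..m} \<times> {1..n}" "y \<in> {1..m} \<times> {1..n}" "3 \<le> n"
  shows "{x, y} \<in> snd (cylindric_grid m n) \<longleftrightarrow> adjacent n x y"
proof -
  obtain i j i' j' where xy: "x = (i, j)" "y = (i', j')" by (cases x; cases y) auto
  show ?thesis
  proof
    assume "{x, y} \<in> snd (cylindric_grid m n)"
    then show "adjacent n x y"
      unfolding cylindric_grid_def adjacent_def xy by (auto simp: doubleton_eq_iff)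
  next
    assume "adjacent n x y"
    then consider "i = i'" "j' = j + 1" | "i = i'" "j = j' + 1" | "i = i'" "j = 1" "j' = n"
      | "i = i'" "j = n" "j' = 1" | "j = j'" "i' = i + 1" | "j = j'" "i = i' + 1"
      unfolding adjacent_def xy by auto
    then show "{x, y} \<in> snd (cylindric_grid m n)"
    proof cases
      case 5
      then have "{x, y} = {(i, j), (i + 1, j)} \<and> 1 \<le> i \<and> i \<le> m - 1 \<and> 1 \<le> j \<and> j \<le> n"
        using assms xy by auto
      then show ?thesis unfolding cylindric_grid_def snd_conv by blast
    next
      case 6
      then have "{x, y} = {(i', j), (i' + 1, j)} \<and> 1 \<le> i' \<and> i' \<le> m - 1 \<and> 1 \<le> j \<and> j \<le> n"
        using assms xy by auto
      then show ?thesis unfolding cylindric_grid_def snd_conv by blast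
    qed (use assms in \<open>auto simp: cylindric_grid_def xy doubleton_eq_iff\<close>)
  qed
qed

text \<open>
  The 3-uniform word is obtained by sorting the occurrences of all letters lexicographically by keys
  (block, slot, position in the slot). Rows are grouped in pairs: in the word restricted to rows
  \<open>z = 2h - 1\<close>, \<open>a = 2h\<close>, \<open>b = 2h + 1\<close>, the block \<open>h + 2\<close> consists of the slots
  \<open>z\<^sub>j a\<^sub>j\<^sub>-\<^sub>1 b\<^sub>j\<^sub>+\<^sub>1 b\<^sub>j a\<^sub>j\<^sub>+\<^sub>1\<close>, so that consecutive columns overlap. Slots are numbered from 2
  and column \<open>j\<close> has its own slot \<open>j + 2\<close>. The columns \<open>1\<close> and \<open>n\<close> close up the cycle by having their
  first occurrences one or two blocks earlier than the other columns, just before the first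
  occurrence of column \<open>n - 1\<close> there.
\<close>

inductive key_row ::
  "nat \<Rightarrow> nat \<Rightarrow> nat \<Rightarrow> nat \<Rightarrow> nat \<times> nat \<times> nat \<Rightarrow> nat \<times> nat \<times> nat \<Rightarrow> nat \<times> nat \<times> nat \<Rightarrow> bool"
  for n h where
  odd_first: "key_row n h (2 * h + 1) 1 (h, n, 5) (h + 2, 3, 10) (h + 3, 3, 0)"
| odd_last: "key_row n h (2 * h + 1) n (h + 1, n, 4) (h + 2, n + 1, 8) (h + 3, 3, 2)"
| odd_mid: "1 < j \<Longrightarrow> j < n \<Longrightarrow>
     key_row n h (2 * h + 1) j (h + 2, j + 1, 8) (h + 2, j + 2, 10) (h + 3, j + 2, 0)"
| even_first: "key_row n h (2 * h + 2) 1 (h, n, 6) (h + 3, 2, 11) (h + 3, 4, 3)"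
| even_last: "key_row n h (2 * h + 2) n (h + 1, n, 7) (h + 3, 3, 1) (h + 3, n + 1, 11)"
| even_mid: "1 < j \<Longrightarrow> j < n \<Longrightarrow>
     key_row n h (2 * h + 2) j (h + 2, j + 1, 9) (h + 3, j + 1, 11) (h + 3, j + 3, 3)"

text \<open>Rows \<open>2 * h + 1\<close> and \<open>2 * h + 2\<close> share the index
  \<open>h\<close>, whence \<open>(i - 1) div 2\<close>.\<close>

lemma key_row_exists:
  assumes "1 \<le> i" "1 \<le> j" "j \<le> n"
  shows "\<exists>p q r. key_row n ((i - 1) div 2) i j p q r"
proof -
  define h where "h = (i - 1) div 2"
  consider "i = 2 * h + 1" | "i = 2 * h + 2" using assms(1) unfolding h_def by linarith
  moreover consider "j = 1" | "j = n" | "1 < j" "j < n" using assms by linarith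
  ultimately show ?thesis
    unfolding h_def[symmetric] by (metis key_row.intros)
qed

lemma lex_iff:
  "(a, b, c) < (a', b', c') \<longleftrightarrow> a < a' \<or> a = a' \<and> (b < b' \<or> b = b' \<and> c < c')" for a b c :: nat
  by auto

lemma key_row_increasing:
  assumes "key_row n h i j p q r" "3 \<le> n"
  shows "p < q \<and> q < r"
  by (rule key_row.cases[OF assms(1)]; insert assms(2); hypsubst_thin; simp add: lex_iff)

text \<open>A key determines its vertex. Each position number belongs to one parity of rows with a
  fixed block offset, which gives the row; it occurs either for a single column, \<open>1\<close> or
  \<open>n\<close>, or with the slot at a fixed offset from the column.\<close>

lemma key_row_disjoint:
  assumes "key_row n h i j p q r" "key_row n h' i' j' p' q' r'" "(i, j) \<noteq> (i', j')" "3 \<le> n"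
  shows "{p, q, r} \<inter> {p', q', r'} = {}"
  by (rule key_row.cases[OF assms(1)]; rule key_row.cases[OF assms(2)];
      insert assms(3,4); hypsubst_thin; simp; linarith?)

lemma key_row_interleaved_iff_le:
  assumes "key_row n h i j p q r" "key_row n h' i' j' p' q' r'" "(i, j) \<noteq> (i', j')" "3 \<le> n" "h \<le> h'"
  shows "interleaved p q r p' q' r' \<or> interleaved p' q' r' p q r \<longleftrightarrow> adjacent n (i, j) (i', j')"
proof -
  \<comment> \<open>Keys with index \<open>h\<close> lie in blocks \<open>h\<close> to
    \<open>h + 3\<close>, so from difference 4 on all keys of one vertex precede those of the
    other.\<close>
  consider "h' = h" | "h' = h + 1" | "h' = h + 2" | "h' = h + 3" | "h' \<ge> h + 4"
    using assms(5) by linarith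
  then show ?thesis
    by (cases; insert assms(3,4); rule key_row.cases[OF assms(1)]; rule key_row.cases[OF assms(2)];
      hypsubst_thin; simp add: interleaved_def adjacent_def lex_iff; linarith?)
qed

lemma key_row_interleaved_iff:
  assumes "key_row n h i j p q r" "key_row n h' i' j' p' q' r'" "(i, j) \<noteq> (i', j')" "3 \<le> n"
  shows "interleaved p q r p' q' r' \<or> interleaved p' q' r' p q r \<longleftrightarrow> adjacent n (i, j) (i', j')"
proof (cases "h \<le> h'")
  case True
  then show ?thesis using key_row_interleaved_iff_le assms by blast
next
  case False
  then show ?thesis
    using key_row_interleaved_iff_le[OF assms(2,1)] assms(3,4) adjacent_commute[of n "(i, j)"] by auto
qed

lemma cylindric_grid_3_representable:
  assumes "3 \<le> n"
  shows "k_representable 3 (cylindric_grid m n)"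
proof -
  define V where "V = {1..m} \<times> {1..n}"
  have "\<forall>x\<in>V. \<exists>h p q r. key_row n h (fst x) (snd x) p q r"
    using key_row_exists unfolding V_def by fastforce
  then obtain h p q r where row: "key_row n (h x) (fst x) (snd x) (p x) (q x) (r x)" if "x \<in> V" for x
    by metis
  define K where "K x = {p x, q x, r x}" for x
  note inc = key_row_increasing[OF row assms]
  have disj: "K x \<inter> K y = {}" if "x \<in> V" "y \<in> V" "x \<noteq> y" for x y
    unfolding K_def by (rule key_row_disjoint[OF row row]) (use that assms in \<open>auto simp: prod_eq_iff\<close>)
  have card: "card (K x) = 3" if "x \<in> V" for x
    using inc[OF that] less_trans[of "p x" "q x" "r x"] by (simp add: K_def less_imp_neq)
  have "finite V" by (simp add: V_def)
  moreover have "finite (K x)" for x by (simp add: K_def)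
  moreover have "disjoint_family_on K V" using disj by (auto simp: disjoint_family_on_def)
  ultimately obtain w where w: "set w \<subseteq> V" "\<And>x. x \<in> V \<Longrightarrow> count_list w x = card (K x)"
    "\<And>x y. x \<in> V \<Longrightarrow> y \<in> V \<Longrightarrow> x \<noteq> y \<Longrightarrow>
       alternate w x y \<longleftrightarrow> splits (K y) (K x) \<and> splits (K x) (K y)"
    using word_of_occurrences[of V K] by metis
  have count: "count_list w x = 3" if "x \<in> V" for x using w(2) card that by simp
  then have "x \<in> set w" if "x \<in> V" for x
    using that count_notin[of x w] by fastforce
  then have "set w = V" using w(1) by auto
  moreover have "alternate w x y \<longleftrightarrow> adjacent n x y" if xy: "x \<in> V" "y \<in> V" "x \<noteq> y" for x y
  proof -
    have "p x \<noteq> p y" using disj[OF xy] by (auto simp: K_def)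
    then have "alternate w x y \<longleftrightarrow>
        interleaved (p x) (q x) (r x) (p y) (q y) (r y) \<or> interleaved (p y) (q y) (r y) (p x) (q x) (r x)"
      unfolding w(3)[OF xy] K_def
      using inc[OF xy(1)] inc[OF xy(2)] by (intro splits_triple_iff) auto
    also have "\<dots> \<longleftrightarrow> adjacent n x y"
      using key_row_interleaved_iff[OF row[OF xy(1)] row[OF xy(2)] _ assms] xy(3) by (simp add: prod_eq_iff)
    finally show ?thesis .
  qed
  ultimately have "represents w (cylindric_grid m n)"
    unfolding represents_def cylindric_grid_vertices V_def
    using cylindric_grid_edge_iff[OF _ _ assms] by metis
  then show ?thesis
    unfolding k_representable_def cylindric_grid_vertices using count[unfolded V_def] by metis
qed

section \<open>Chord diagrams\<close>

text \<open>Meant for \<open>a < b\<close> and \<open>a' < b'\<close>: two chords of a circle that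
  has been cut open to a line.\<close>

definition crossing :: "nat \<Rightarrow> nat \<Rightarrow> nat \<Rightarrow> nat \<Rightarrow> bool" where
  "crossing a b a' b' \<longleftrightarrow> a < a' \<and> a' < b \<and> b < b' \<or> a' < a \<and> a < b' \<and> b' < b"

text \<open>Crossing depends only on the cyclic order. Cutting the circle at \<open>s\<close> moves
  the points before \<open>s\<close> behind all others; \<open>min\<close> and \<open>max\<close>
  reorder the ends of a chord reversed by the cut.\<close>

lemma crossing_rotate:
  fixes s :: nat
  assumes "a < b" "a' < b'" "b < N" "b' < N" "{a, b} \<inter> {a', b'} = {}"
  defines "r \<equiv> \<lambda>p. if p < s then p + N else p"
  shows "crossing (min (r a) (r b)) (max (r a) (r b)) (min (r a') (r b')) (max (r a') (r b')) \<longleftrightarrow>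
    crossing a b a' b'"
  using assms(1-5) unfolding crossing_def r_def min_def max_def
  by (cases "a < s"; cases "b < s"; cases "a' < s"; cases "b' < s"; auto)

text \<open>The rotation is used to let the chord of a chosen letter \<open>c\<close> start first. A
  chord crossing it then has to start before \<open>g c\<close> and end after it.\<close>

lemma chords_of_2_uniform:
  assumes unif: "\<And>x. x \<in> V \<Longrightarrow> count_list w x = 2" and c: "c \<in> V"
  obtains f g :: "'a \<Rightarrow> nat" where
    "\<And>x. x \<in> V \<Longrightarrow> f x < g x"
    "\<And>x y. x \<in> V \<Longrightarrow> y \<in> V \<Longrightarrow> x \<noteq> y \<Longrightarrow> {f x, g x} \<inter> {f y, g y} = {}"
    "\<And>x. x \<in> V \<Longrightarrow> x \<noteq> c \<Longrightarrow> f c < f x"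
    "\<And>x y. x \<in> V \<Longrightarrow> y \<in> V \<Longrightarrow> x \<noteq> y \<Longrightarrow> alternate w x y \<longleftrightarrow> crossing (f x) (g x) (f y) (g y)"
proof -
  have "\<forall>x\<in>V. \<exists>a b. a < b \<and> occurrences w x = {a, b}"
  proof
    fix x assume "x \<in> V"
    then have "card (occurrences w x) = 2" using unif card_occurrences by metis
    then obtain a b where "occurrences w x = {a, b}" "a \<noteq> b" by (auto simp: card_2_iff)
    then show "\<exists>a b. a < b \<and> occurrences w x = {a, b}"
      by (metis insert_commute neqE)
  qed
  then obtain a b where ab: "a x < b x" "occurrences w x = {a x, b x}" if "x \<in> V" for x
    by metis
  have disj: "{a x, b x} \<inter> {a y, b y} = {}" if "x \<in> V" "y \<in> V" "x \<noteq> y" for x y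
  proof -
    have "occurrences w x \<inter> occurrences w y = {}" using that by (auto simp: occurrences_def)
    then show ?thesis using ab that by simp
  qed
  have bN: "b x < length w" if "x \<in> V" for x
    using ab(2)[OF that] by (auto simp: occurrences_def)
  \<comment> \<open>The rotation fixes \<open>a c\<close> and moves all earlier positions to the
    end, so \<open>f c = a c\<close> is the least end.\<close>
  define r where "r p = (if p < a c then p + length w else p)" for p
  define f where "f x = min (r (a x)) (r (b x))" for x
  define g where "g x = max (r (a x)) (r (b x))" for x
  have r_inj: "r p = r q \<longleftrightarrow> p = q" if "p < length w" "q < length w" for p q
    using that by (auto simp: r_def)
  show thesis
  proof
    show "f x < g x" if "x \<in> V" for x
      using ab(1)[OF that] bN[OF that] r_inj[of "a x" "b x"] by (auto simp: f_def g_def min_def max_def)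
    show "{f x, g x} \<inter> {f y, g y} = {}" if "x \<in> V" "y \<in> V" "x \<noteq> y" for x y
      using disj[OF that] ab(1)[OF that(1)] ab(1)[OF that(2)] bN[OF that(1)] bN[OF that(2)] r_inj
      by (auto simp: f_def g_def min_def max_def)
    show "f c < f x" if "x \<in> V" "x \<noteq> c" for x
      using disj[OF that(1) c that(2)] ab(1)[OF that(1)] ab(1)[OF c] bN[OF that(1)] bN[OF c]
      by (auto simp: f_def r_def min_def)
    show "alternate w x y \<longleftrightarrow> crossing (f x) (g x) (f y) (g y)" if xy: "x \<in> V" "y \<in> V" "x \<noteq> y" for x y
    proof -
      have "alternate w x y \<longleftrightarrow> crossing (a x) (b x) (a y) (b y)"
        unfolding alternate_iff_occurrences[OF xy(3)] ab(2)[OF xy(1)] ab(2)[OF xy(2)] crossing_def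
        using disj[OF xy] ab(1)[OF xy(1)] ab(1)[OF xy(2)] by (intro splits_pair_iff) auto
      also have "\<dots> \<longleftrightarrow> crossing (f x) (g x) (f y) (g y)"
        unfolding f_def g_def r_def
        by (rule crossing_rotate[symmetric])
          (use disj[OF xy] ab(1)[OF xy(1)] ab(1)[OF xy(2)] bN[OF xy(1)] bN[OF xy(2)] in auto)
      finally show ?thesis .
    qed
  qed
qed

section \<open>The 3 by 3 grid has no chord diagram\<close>

text \<open>In its use, \<open>b\<close> is the second end of a central chord crossed by
  \<open>x\<close>, \<open>y\<close>, \<open>u\<close> and avoided by \<open>d\<close>. If
  \<open>u\<close> started between \<open>x\<close> and \<open>y\<close>, it would also end between
  them. On its side of \<open>b\<close>, the chord \<open>d\<close> would then enclose an end of
  \<open>u\<close> whose other end lies beyond \<open>b\<close>, and so cross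
  \<open>u\<close>.\<close>

lemma no_chord_between:
  assumes x: "x1 < b" "b < x2" and y: "y1 < b" "b < y2" and u: "u1 < b" "b < u2" and d: "d2 < b \<or> b < d1" "d1 < d2"
    and nc: "\<not> crossing x1 x2 u1 u2" "\<not> crossing y1 y2 u1 u2" "\<not> crossing d1 d2 u1 u2"
    and cr: "crossing d1 d2 x1 x2" "crossing d1 d2 y1 y2"
    and neq: "u2 \<noteq> x2" "u2 \<noteq> y2"
  shows "\<not> (x1 < u1 \<and> u1 < y1)"
proof
  assume *: "x1 < u1 \<and> u1 < y1"
  then have **: "y2 < u2" "u2 < x2" using x y u nc(1,2) neq unfolding crossing_def by auto
  from d(1) show False
  proof
    assume "d2 < b"
    then have "d1 < x1" "y1 < d2" using cr x y unfolding crossing_def by auto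
    then show False using * u \<open>d2 < b\<close> nc(3) unfolding crossing_def by auto
  next
    assume "b < d1"
    then have "d1 < y2" "x2 < d2" using cr x y unfolding crossing_def by auto
    then show False using ** u \<open>b < d1\<close> nc(3) unfolding crossing_def by auto
  qed
qed

text \<open>The pairs \<open>a, b\<close>, \<open>b, c\<close>, \<open>c, d\<close> and
  \<open>d, a\<close> would all be consecutive among four distinct points, but four points on a line
  have only three consecutive pairs. The union of two intervals covers both possible orders of a
  pair.\<close>

lemma no_cyclic_neighbours:
  fixes a b c d :: "'k :: linorder"
  assumes "c \<notin> {a..b} \<union> {b..a}" "d \<notin> {a..b} \<union> {b..a}"
    and "d \<notin> {b..c} \<union> {c..b}" "a \<notin> {b..c} \<union> {c..b}"
    and "a \<notin> {c..d} \<union> {d..c}" "b \<notin> {c..d} \<union> {d..c}"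
    and "b \<notin> {d..a} \<union> {a..d}" "c \<notin> {d..a} \<union> {a..d}"
  shows False
  using assms by (simp; metis linear order_trans)

lemma no_chord_diagram_3x3:
  assumes chord: "\<And>x. x \<in> {1..3} \<times> {1..3} \<Longrightarrow> (f x :: nat) < g x"
    and disj: "\<And>x y. x \<in> {1..3} \<times> {1..3} \<Longrightarrow> y \<in> {1..3} \<times> {1..3} \<Longrightarrow> x \<noteq> y \<Longrightarrow> {f x, g x} \<inter> {f y, g y} = {}"
    and first: "\<And>x. x \<in> {1..3} \<times> {1..3} \<Longrightarrow> x \<noteq> (2, 2) \<Longrightarrow> f (2, 2) < f x"
    and cross: "\<And>x y. x \<in> {1..3} \<times> {1..3} \<Longrightarrow> y \<in> {1..3} \<times> {1..3} \<Longrightarrow> x \<noteq> y \<Longrightarrow>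
      crossing (f x) (g x) (f y) (g y) \<longleftrightarrow> adjacent n x y"
    and n: "4 \<le> n"
  shows False
proof -
  let ?V = "{1..3} \<times> {1..3} :: (nat \<times> nat) set" and ?b = "g (2, 2)"
  have side: "f x < ?b \<and> ?b < g x" if "x \<in> ?V" "x \<noteq> (2, 2)" "adjacent n (2, 2) x" for x
    using cross[of "(2, 2)" x] first[OF that(1,2)] that unfolding crossing_def by auto
  \<comment> \<open>Since \<open>f (2, 2)\<close> is the least end, avoiding the central chord means
    lying on one side of \<open>?b\<close>.\<close>
  have corner: "g x < ?b \<or> ?b < f x" if "x \<in> ?V" "x \<noteq> (2, 2)" "\<not> adjacent n (2, 2) x" for x
    using cross[of "(2, 2)" x] first[OF that(1,2)] chord[OF that(1)] disj[of x "(2, 2)"] that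
    unfolding crossing_def by fastforce
  have between: "\<not> (f x < f u \<and> f u < f y)"
    if V: "x \<in> ?V" "y \<in> ?V" "u \<in> ?V" "d \<in> ?V"
      and "distinct [(2, 2), x, y, u, d]"
      and "adjacent n (2, 2) x" "adjacent n (2, 2) y" "adjacent n (2, 2) u" "\<not> adjacent n (2, 2) d"
      and "\<not> adjacent n x u" "\<not> adjacent n y u" "\<not> adjacent n d u" "adjacent n d x" "adjacent n d y"
    for x y u d
  proof -
    have ne: "x \<noteq> (2, 2)" "y \<noteq> (2, 2)" "u \<noteq> (2, 2)" "d \<noteq> (2, 2)" "x \<noteq> u" "y \<noteq> u" "d \<noteq> u" "d \<noteq> x" "d \<noteq> y"
      using that(5) by auto
    have "g u \<noteq> g x" "g u \<noteq> g y" using disj[OF V(1,3) ne(5)] disj[OF V(2,3) ne(6)] by auto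
    then show ?thesis
      using side[OF V(1) ne(1)] side[OF V(2) ne(2)] side[OF V(3) ne(3)] corner[OF V(4) ne(4)] chord[OF V(4)]
        cross[OF V(1,3) ne(5)] cross[OF V(2,3) ne(6)] cross[OF V(4,3) ne(7)]
        cross[OF V(4,1) ne(8)] cross[OF V(4,2) ne(9)] that(6-)
      by (intro no_chord_between[of _ ?b "g x" _ "g y" _ "g u" "g d" "f d"]) simp_all
  qed
  have outside: "f u \<notin> {f x..f y} \<union> {f y..f x}"
    if "x \<in> ?V" "y \<in> ?V" "u \<in> ?V" "d \<in> ?V"
      and "distinct [(2, 2), x, y, u, d]"
      and "adjacent n (2, 2) x" "adjacent n (2, 2) y" "adjacent n (2, 2) u" "\<not> adjacent n (2, 2) d"
      and "\<not> adjacent n x u" "\<not> adjacent n y u" "\<not> adjacent n d u" "adjacent n d x" "adjacent n d y"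
    for x y u d
  proof -
    have "f u \<noteq> f x" "f u \<noteq> f y" using disj[OF that(3,1)] disj[OF that(3,2)] that(5) by auto
    moreover have "\<not> (f x < f u \<and> f u < f y)" by (rule between) (fact that)+
    moreover have "\<not> (f y < f u \<and> f u < f x)"
      by (rule between[where d = d]) (use that in auto)
    ultimately show ?thesis by (simp add: order.order_iff_strict)
  qed
  \<comment> \<open>No wrap-around edge joins two of the columns 1 to 3.\<close>
  have n': "n \<noteq> 1" "n \<noteq> 2" "n \<noteq> 3" using n by auto
  show False
  \<comment> \<open>These are the neighbours of the centre in cyclic order. For each consecutive
    pair, the corner adjacent to both plays the role of \<open>d\<close> in
    \<open>outside\<close>.\<close>
  proof (rule no_cyclic_neighbours[where a = "f (1, 2)" and b = "f (2, 3)" and c = "f (3, 2)" and d = "f (2, 1)"])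
    show "f (3, 2) \<notin> {f (1, 2)..f (2, 3)} \<union> {f (2, 3)..f (1, 2)}"
      "f (2, 1) \<notin> {f (1, 2)..f (2, 3)} \<union> {f (2, 3)..f (1, 2)}"
      by (rule outside[where d = "(1, 3)"]; use n' in \<open>simp add: adjacent_simp\<close>)+
    show "f (2, 1) \<notin> {f (2, 3)..f (3, 2)} \<union> {f (3, 2)..f (2, 3)}"
      "f (1, 2) \<notin> {f (2, 3)..f (3, 2)} \<union> {f (3, 2)..f (2, 3)}"
      by (rule outside[where d = "(3, 3)"]; use n' in \<open>simp add: adjacent_simp\<close>)+
    show "f (1, 2) \<notin> {f (3, 2)..f (2, 1)} \<union> {f (2, 1)..f (3, 2)}"
      "f (2, 3) \<notin> {f (3, 2)..f (2, 1)} \<union> {f (2, 1)..f (3, 2)}"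
      by (rule outside[where d = "(3, 1)"]; use n' in \<open>simp add: adjacent_simp\<close>)+
    show "f (2, 3) \<notin> {f (2, 1)..f (1, 2)} \<union> {f (1, 2)..f (2, 1)}"
      "f (3, 2) \<notin> {f (2, 1)..f (1, 2)} \<union> {f (1, 2)..f (2, 1)}"
      by (rule outside[where d = "(1, 1)"]; use n' in \<open>simp add: adjacent_simp\<close>)+
  qed
qed

section \<open>The triangular prism has no chord diagram\<close>

text \<open>Opposite points among the six belong to the same chord, so an arc with at most three of
  them contains no chord's both ends. Hence the chord from \<open>u\<close> to \<open>v\<close>
  crosses as many of the three chords as there are points on its smaller side. If it crosses just
  one, it isolates one of that chord's two ends; these are the two alternatives.\<close>

lemma chord_across_triangle:
  fixes p1 p2 p3 q1 q2 q3 u v :: nat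
  assumes o: "p1 < p2" "p2 < p3" "p3 < q1" "q1 < q2" "q2 < q3" and uv: "p1 < u" "u < v"
    and u: "u \<notin> {p2, p3, q1, q2, q3}" and v: "v \<notin> {p2, p3, q1, q2, q3}"
  shows "crossing p1 q1 u v \<Longrightarrow> \<not> crossing p2 q2 u v \<Longrightarrow> \<not> crossing p3 q3 u v \<Longrightarrow>
      u < p2 \<and> q3 < v \<or> p3 < u \<and> u < q1 \<and> q1 < v \<and> v < q2"
    and "\<not> crossing p1 q1 u v \<Longrightarrow> crossing p2 q2 u v \<Longrightarrow> \<not> crossing p3 q3 u v \<Longrightarrow>
      u < p2 \<and> p2 < v \<and> v < p3 \<or> q1 < u \<and> u < q2 \<and> q2 < v \<and> v < q3"
    and "\<not> crossing p1 q1 u v \<Longrightarrow> \<not> crossing p2 q2 u v \<Longrightarrow> crossing p3 q3 u v \<Longrightarrow>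
      p2 < u \<and> u < p3 \<and> p3 < v \<and> v < q1 \<or> q2 < u \<and> u < q3 \<and> q3 < v"
proof -
  have "u < p2 \<or> p2 < u \<and> u < p3 \<or> p3 < u \<and> u < q1 \<or> q1 < u \<and> u < q2 \<or> q2 < u \<and> u < q3 \<or> q3 < u"
    using u by fastforce
  moreover have "v < p2 \<or> p2 < v \<and> v < p3 \<or> p3 < v \<and> v < q1 \<or> q1 < v \<and> v < q2 \<or> q2 < v \<and> v < q3 \<or> q3 < v"
    using v by fastforce
  ultimately have
    "(crossing p1 q1 u v \<longrightarrow> \<not> crossing p2 q2 u v \<longrightarrow> \<not> crossing p3 q3 u v \<longrightarrow>
      u < p2 \<and> q3 < v \<or> p3 < u \<and> u < q1 \<and> q1 < v \<and> v < q2) \<and>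
     (\<not> crossing p1 q1 u v \<longrightarrow> crossing p2 q2 u v \<longrightarrow> \<not> crossing p3 q3 u v \<longrightarrow>
      u < p2 \<and> p2 < v \<and> v < p3 \<or> q1 < u \<and> u < q2 \<and> q2 < v \<and> v < q3) \<and>
     (\<not> crossing p1 q1 u v \<longrightarrow> \<not> crossing p2 q2 u v \<longrightarrow> crossing p3 q3 u v \<longrightarrow>
      p2 < u \<and> u < p3 \<and> p3 < v \<and> v < q1 \<or> q2 < u \<and> u < q3 \<and> q3 < v)"
    using o uv unfolding crossing_def by (elim disjE conjE; simp)
  then show "crossing p1 q1 u v \<Longrightarrow> \<not> crossing p2 q2 u v \<Longrightarrow> \<not> crossing p3 q3 u v \<Longrightarrow>
      u < p2 \<and> q3 < v \<or> p3 < u \<and> u < q1 \<and> q1 < v \<and> v < q2"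
    and "\<not> crossing p1 q1 u v \<Longrightarrow> crossing p2 q2 u v \<Longrightarrow> \<not> crossing p3 q3 u v \<Longrightarrow>
      u < p2 \<and> p2 < v \<and> v < p3 \<or> q1 < u \<and> u < q2 \<and> q2 < v \<and> v < q3"
    and "\<not> crossing p1 q1 u v \<Longrightarrow> \<not> crossing p2 q2 u v \<Longrightarrow> crossing p3 q3 u v \<Longrightarrow>
      p2 < u \<and> u < p3 \<and> p3 < v \<and> v < q1 \<or> q2 < u \<and> u < q3 \<and> q3 < v"
    by blast+
qed

lemma no_chord_diagram_prism:
  assumes chord: "\<And>x. x \<in> {1..2} \<times> {1..3} \<Longrightarrow> (f x :: nat) < g x"
    and disj: "\<And>x y. x \<in> {1..2} \<times> {1..3} \<Longrightarrow> y \<in> {1..2} \<times> {1..3} \<Longrightarrow> x \<noteq> y \<Longrightarrow> {f x, g x} \<inter> {f y, g y} = {}"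
    and first: "\<And>x. x \<in> {1..2} \<times> {1..3} \<Longrightarrow> x \<noteq> (1, 1) \<Longrightarrow> f (1, 1) < f x"
    and cross: "\<And>x y. x \<in> {1..2} \<times> {1..3} \<Longrightarrow> y \<in> {1..2} \<times> {1..3} \<Longrightarrow> x \<noteq> y \<Longrightarrow>
      crossing (f x) (g x) (f y) (g y) \<longleftrightarrow> adjacent 3 x y"
  shows False
proof -
  \<comment> \<open>With three columns any two are adjacent, columns 1 and 3 by the wrap-around
    edge.\<close>
  have adj: "adjacent 3 (i, j) (i', j') \<longleftrightarrow> i = i' \<or> j = j'"
    if "i \<in> {1, 2}" "i' \<in> {1, 2}" "j \<in> {1, 2, 3}" "j' \<in> {1, 2, 3}" "(i, j) \<noteq> (i', j')" for i i' j j' :: nat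
    using that by (elim insertE emptyE; simp add: adjacent_simp)
  \<comment> \<open>Columns 2 and 3 are named \<open>a\<close> and \<open>b\<close> by the order in
    which their first-row chords start.\<close>
  have False if ab: "(a, b) \<in> {(2, 3), (3, 2)}" and less: "f (1, a) < f (1, b)" for a b :: nat
  proof -
    have V: "(i, j) \<in> {1..2} \<times> {1..3}" if "i \<in> {1, 2}" "j \<in> {1, a, b}" for i j :: nat using ab that by auto
    have c: "crossing (f (i, j)) (g (i, j)) (f (i', j')) (g (i', j')) \<longleftrightarrow> i = i' \<or> j = j'"
      if "i \<in> {1, 2}" "i' \<in> {1, 2}" "j \<in> {1, a, b}" "j' \<in> {1, a, b}" "(i, j) \<noteq> (i', j')" for i i' j j' :: nat
    proof -
      have "j \<in> {1, 2, 3}" "j' \<in> {1, 2, 3}" using that ab by auto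
      then show ?thesis using cross[OF V[OF that(1,3)] V[OF that(2,4)] that(5)] adj that(1,2,5) by blast
    qed
    \<comment> \<open>Pairwise crossing puts all starts before all ends, both in the same
      order.\<close>
    have o: "f (1, 1) < f (1, a)" "f (1, a) < f (1, b)" "f (1, b) < g (1, 1)" "g (1, 1) < g (1, a)" "g (1, a) < g (1, b)"
      using less first[of "(1, a)"] first[of "(1, b)"] c[of 1 1 1 a] c[of 1 1 1 b] c[of 1 1 a b] ab
      unfolding crossing_def by auto
    have ends: "f (1, 1) < f (2, j)" "f (2, j) < g (2, j)"
      "f (2, j) \<notin> {f (1, a), f (1, b), g (1, 1), g (1, a), g (1, b)}"
      "g (2, j) \<notin> {f (1, a), f (1, b), g (1, 1), g (1, a), g (1, b)}" if "j \<in> {1, a, b}" for j :: nat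
    proof -
      have j: "(2 :: nat, j) \<in> {1..2} \<times> {1..3}" by (rule V) (use that in auto)
      show "f (1, 1) < f (2, j)" "f (2, j) < g (2, j)" using first[OF j] chord[OF j] by simp_all
      have "{f (2, j), g (2, j)} \<inter> {f (1, j'), g (1, j')} = {}" if "j' \<in> {1, a, b}" for j' :: nat
        by (rule disj[OF j V]) (use that in auto)
      from this[of 1] this[of a] this[of b]
      show "f (2, j) \<notin> {f (1, a), f (1, b), g (1, 1), g (1, a), g (1, b)}"
        "g (2, j) \<notin> {f (1, a), f (1, b), g (1, 1), g (1, a), g (1, b)}" by auto
    qed
    have ne: "a \<noteq> 1" "b \<noteq> 1" "a \<noteq> b" using ab by auto
    have c12: "crossing (f (1, j)) (g (1, j)) (f (2, j')) (g (2, j')) \<longleftrightarrow> j = j'"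
      if "j \<in> {1, a, b}" "j' \<in> {1, a, b}" for j j'
      using c[of 1 2 j j'] that by simp
    note gap = chord_across_triangle[OF o ends]
    \<comment> \<open>Each second-row chord crosses only the first-row chord of its own column, so
      it isolates one end of that chord.\<close>
    have "f (2, 1) < f (1, a) \<and> g (1, b) < g (2, 1) \<or>
        f (1, b) < f (2, 1) \<and> f (2, 1) < g (1, 1) \<and> g (1, 1) < g (2, 1) \<and> g (2, 1) < g (1, a)"
      by (rule gap(1)) (use ne in \<open>simp_all add: c12 del: One_nat_def\<close>)
    moreover have "f (2, a) < f (1, a) \<and> f (1, a) < g (2, a) \<and> g (2, a) < f (1, b) \<or>
        g (1, 1) < f (2, a) \<and> f (2, a) < g (1, a) \<and> g (1, a) < g (2, a) \<and> g (2, a) < g (1, b)"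
      by (rule gap(2)) (use ne in \<open>simp_all add: c12 del: One_nat_def\<close>)
    moreover have "f (1, a) < f (2, b) \<and> f (2, b) < f (1, b) \<and> f (1, b) < g (2, b) \<and> g (2, b) < g (1, 1) \<or>
        g (1, a) < f (2, b) \<and> f (2, b) < g (1, b) \<and> g (1, b) < g (2, b)"
      by (rule gap(3)) (use ne in \<open>simp_all add: c12 del: One_nat_def\<close>)
    moreover have "crossing (f (2, 1)) (g (2, 1)) (f (2, a)) (g (2, a))" "crossing (f (2, 1)) (g (2, 1)) (f (2, b)) (g (2, b))"
      "crossing (f (2, a)) (g (2, a)) (f (2, b)) (g (2, b))"
      using c[of 2 2 1 a] c[of 2 2 1 b] c[of 2 2 a b] ne by simp_all
    \<comment> \<open>Each of the eight choices of isolated ends contains two that are not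
      neighbours on the circle, and chords isolating such ends do not cross.\<close>
    ultimately show False using o unfolding crossing_def by (elim disjE) auto
  qed
  from this[of 2 3] this[of 3 2] have "f (1, 2) = f (1, 3)" by (meson insertI1 insertI2 neqE)
  then show False using disj[of "(1, 2)" "(1, 3)"] by auto
qed

section \<open>Lower bounds for the representation number\<close>

text \<open>A chord diagram restricts to any set of vertices, so it suffices to exclude one for an
  induced subgraph.\<close>

lemma cylindric_grid_not_2_representable:
  assumes "3 \<le> m" "3 \<le> n"
  shows "\<not> k_representable 2 (cylindric_grid m n)"
proof
  define V where "V = {1..m} \<times> {1..n}"
  assume "k_representable 2 (cylindric_grid m n)"
  then obtain w where w: "represents w (cylindric_grid m n)" "\<And>x. x \<in> V \<Longrightarrow> count_list w x = 2"
    unfolding k_representable_def cylindric_grid_vertices V_def by blast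
  have alt: "alternate w x y \<longleftrightarrow> adjacent n x y" if "x \<in> V" "y \<in> V" "x \<noteq> y" for x y
    using w(1) that cylindric_grid_edge_iff[OF _ _ assms(2)]
    unfolding represents_def cylindric_grid_vertices V_def by metis
  show False
  \<comment> \<open>For \<open>n = 3\<close> the wrap-around edges join columns 1 and 3, so the
    first three columns do not induce a grid; rows 1 and 2 give a prism instead.\<close>
  proof (cases "n = 3")
    case True
    have sub: "x \<in> V" if "x \<in> {1..2} \<times> {1..3}" for x using that assms True by (auto simp: V_def)
    obtain f g where fg: "\<And>x. x \<in> V \<Longrightarrow> f x < g x"
      "\<And>x y. x \<in> V \<Longrightarrow> y \<in> V \<Longrightarrow> x \<noteq> y \<Longrightarrow> {f x, g x} \<inter> {f y, g y} = {}"
      "\<And>x. x \<in> V \<Longrightarrow> x \<noteq> (1, 1) \<Longrightarrow> f (1, 1) < f x"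
      "\<And>x y. x \<in> V \<Longrightarrow> y \<in> V \<Longrightarrow> x \<noteq> y \<Longrightarrow> alternate w x y \<longleftrightarrow> crossing (f x) (g x) (f y) (g y)"
      using chords_of_2_uniform[of V w "(1, 1)"] w(2) sub[of "(1, 1)"] by auto
    show False
    proof (rule no_chord_diagram_prism)
      show "crossing (f x) (g x) (f y) (g y) \<longleftrightarrow> adjacent 3 x y"
        if "x \<in> {1..2} \<times> {1..3}" "y \<in> {1..2} \<times> {1..3}" "x \<noteq> y" for x y
        using fg(4) alt sub that True by metis
    qed (use fg(1-3) sub in simp_all)
  next
    case False
    have sub: "x \<in> V" if "x \<in> {1..3} \<times> {1..3}" for x using that assms by (auto simp: V_def)
    obtain f g where fg: "\<And>x. x \<in> V \<Longrightarrow> f x < g x"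
      "\<And>x y. x \<in> V \<Longrightarrow> y \<in> V \<Longrightarrow> x \<noteq> y \<Longrightarrow> {f x, g x} \<inter> {f y, g y} = {}"
      "\<And>x. x \<in> V \<Longrightarrow> x \<noteq> (2, 2) \<Longrightarrow> f (2, 2) < f x"
      "\<And>x y. x \<in> V \<Longrightarrow> y \<in> V \<Longrightarrow> x \<noteq> y \<Longrightarrow> alternate w x y \<longleftrightarrow> crossing (f x) (g x) (f y) (g y)"
      using chords_of_2_uniform[of V w "(2, 2)"] w(2) sub[of "(2, 2)"] by auto
    show False
    proof (rule no_chord_diagram_3x3)
      show "crossing (f x) (g x) (f y) (g y) \<longleftrightarrow> adjacent n x y"
        if "x \<in> {1..3} \<times> {1..3}" "y \<in> {1..3} \<times> {1..3}" "x \<noteq> y" for x y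
        using fg(4) alt sub that by metis
      show "4 \<le> n" using False assms by simp
    qed (use fg(1-3) sub in simp_all)
  qed
qed

text \<open>The graph is not complete: \<open>(1, 1)\<close> and \<open>(3, 1)\<close> are two rows
  apart.\<close>

lemma cylindric_grid_not_1_representable:
  assumes "3 \<le> m" "3 \<le> n"
  shows "\<not> k_representable 1 (cylindric_grid m n)"
proof
  assume "k_representable 1 (cylindric_grid m n)"
  then obtain w where w: "represents w (cylindric_grid m n)"
      "\<And>x. x \<in> {1..m} \<times> {1..n} \<Longrightarrow> count_list w x = 1"
    unfolding k_representable_def cylindric_grid_vertices by blast
  have V: "(1, 1) \<in> {1..m} \<times> {1..n}" "(3, 1) \<in> {1..m} \<times> {1..n}" using assms by auto
  have "alternate w (1, 1) (3, 1)"
    using w(2) V by (intro alternate_if_1_uniform) auto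
  then have "adjacent n (1, 1) (3, 1)"
    using w(1) V cylindric_grid_edge_iff[OF V assms(2)]
    unfolding represents_def cylindric_grid_vertices by auto
  then show False by (simp add: adjacent_simp)
qed

theorem theorem2:
  fixes m n :: nat
  assumes "m \<ge> 3" and "n \<ge> 3"
  shows "representation_number (cylindric_grid m n) = 3"
proof -
  have rep: "k_representable 3 (cylindric_grid m n)"
    using cylindric_grid_3_representable assms(2) by blast
  then have "word_representable (cylindric_grid m n)"
    unfolding k_representable_def word_representable_def by blast
  moreover have "Inf {enat k |k. k \<ge> 1 \<and> k_representable k (cylindric_grid m n)} = 3"
  proof (rule antisym)
    have "enat 3 \<in> {enat k |k. k \<ge> 1 \<and> k_representable k (cylindric_grid m n)}" using rep by force
    from Inf_lower[OF this] show "Inf {enat k |k. k \<ge> 1 \<and> k_representable k (cylindric_grid m n)} \<le> 3"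
      by (simp only: numeral_eq_enat)
    have "3 \<le> k" if "k \<ge> 1" "k_representable k (cylindric_grid m n)" for k
    proof -
      have "k \<noteq> 1" "k \<noteq> 2"
        using that(2) cylindric_grid_not_1_representable cylindric_grid_not_2_representable assms by blast+
      then show ?thesis using that(1) by linarith
    qed
    then show "3 \<le> Inf {enat k |k. k \<ge> 1 \<and> k_representable k (cylindric_grid m n)}"
      by (intro Inf_greatest) (auto simp: numeral_eq_enat)
  qed
  ultimately show ?thesis unfolding representation_number_def by simp
qed

end
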